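(* Let $\alpha\ge1$ and $\beta\ge\alpha+1$, and let $\mu,\nu>0$ be constants independent of the dimension such that $\mathbb{H}_3^k(\alpha,\beta)\in\mathbb{T}(k,\mu,\nu^k)$ for every integer $k\ge1$. Given an integer $n\ge2$, let $n_1=\lceil\ln n\rceil$, $n_2=\lfloor\frac{n}{n_1}\rfloor$, $n_3=n-n_1n_2$, and $$\mathbb{H}_5^n(\alpha,\beta):=\left((\mathbb{E}^{n_2}\boxtimes\mathbb{H}_3^{n_1}(\alpha,\beta))\vee\mathbf{0}_{n_3}\right)\cup\left(\mathbf{0}_{n_1n_2}\vee\mathbb{H}_3^{n_3}(\alpha,\beta)\right).$$ Then $$\mathbb{H}_5^n(\alpha,\beta)\in\mathbb{T}\left(n,\ \mu\sqrt{\frac{\ln n}{n+\ln n}},\ O\left(n^{1+\ln\nu}\right)\right),$$ where the constant implied by $O(\cdot)$ does not depend on $n$.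
   Context: $\|\cdot\|$ is the Euclidean norm and $\mathbb{S}^n=\{\mathbf{x}\in\mathbb{R}^n:\|\mathbf{x}\|=1\}$. For $\mathbf{v}\in\mathbb{S}^n$ and $-1\le\tau\le1$ let $\mathbb{B}^n(\mathbf{v},\tau)=\{\mathbf{x}\in\mathbb{S}^n:\mathbf{x}^{\rm T}\mathbf{v}\ge\tau\}$. A finite set $\mathbb{H}^n\subseteq\mathbb{S}^n$ is a $\tau$-hitting set if $\bigcup_{\mathbf{v}\in\mathbb{H}^n}\mathbb{B}^n(\mathbf{v},\tau)=\mathbb{S}^n$; $\mathbb{T}(n,\tau,m)$ is the collection of all $\tau$-hitting sets of $\mathbb{S}^n$ with at most $m$ elements. Definition of $\mathbb{H}_3^n(\alpha,\beta)$ for an integer $n\ge1$, $\alpha\ge1$, $\beta\ge\alpha+1$. Let $m=\lceil\log_\beta(\alpha n)\rceil$. An admissible partition is a tuple $(I_1,\dots,I_m)$ of pairwise disjoint (possibly empty) sets with union $\{1,\dots,n\}$ such that $|I_k|=\lfloor \alpha n/\beta^{k-1}\rfloor$ for $k=2,\dots,m$ and $|I_1|=n-\sum_{k=2}^m|I_k|$. For an admissible partition let $$\mathbb{Z}^n(I_1,\dots,I_m)=\{\mathbf{z}\in\mathbb{R}^n: z_i\in\{\pm1,\pm\beta^{(k-1)/2}\}\text{ if } i\in I_k,\ k=1,\dots,m\},$$ let $\mathbb{Z}^n$ be the union of these sets over all admissible partitions, and $\mathbb{H}_3^n(\alpha,\beta)=\{\mathbf{z}/\|\mathbf{z}\|:\mathbf{z}\in\mathbb{Z}^n\}\subseteq\mathbb{S}^n$.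 (In the degenerate case $n=1$, $\alpha=1$, where $m=0$, put $\mathbb{H}_3^1=\{1,-1\}$.) $\mathbb{E}^{k}=\{\mathbf{e}_1,\dots,\mathbf{e}_k\}$ is the standard basis of $\mathbb{R}^k$; $\boxtimes$ is the Kronecker product $\mathbf{x}\boxtimes\mathbf{y}=(x_1\mathbf{y}^{\rm T},x_2\mathbf{y}^{\rm T},\dots)^{\rm T}$; $\vee$ is concatenation of vectors; both operations are applied elementwise to sets of vectors; $\mathbf{0}_k$ is the zero vector in $\mathbb{R}^k$. If $n_3=0$ the second set in the definition of $\mathbb{H}_5^n$ is empty. *)

theory Defs
  imports Complex_Main "Jordan_Normal_Form.Matrix"
begin

text \<open>
  The dimension varies inside the statements, so vectors of \<open>\<real>\<^sup>n\<close> are the elements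
  of \<^term>\<open>carrier_vec n :: real vec set\<close>, with coordinates indexed by \<open>0, \<dots>, n - 1\<close>
  instead of \<open>1, \<dots>, n\<close>.
\<close>

definition eucl_norm :: "real vec \<Rightarrow> real" where
  "eucl_norm x = sqrt (x \<bullet> x)"

definition unit_sphere :: "nat \<Rightarrow> real vec set" where
  "unit_sphere n = {x \<in> carrier_vec n. eucl_norm x = 1}"

definition cap :: "nat \<Rightarrow> real vec \<Rightarrow> real \<Rightarrow> real vec set" where
  "cap n v \<tau> = {x \<in> unit_sphere n. x \<bullet> v \<ge> \<tau>}"

text \<open>Caps are only considered for \<open>-1 \<le> \<tau> \<le> 1\<close>; this range is part of the definition.\<close>

definition hitting_set :: "nat \<Rightarrow> real \<Rightarrow> real vec set \<Rightarrow> bool" where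
  "hitting_set n \<tau> H \<longleftrightarrow>
     -1 \<le> \<tau> \<and> \<tau> \<le> 1 \<and> finite H \<and> H \<subseteq> unit_sphere n \<and>
     (\<Union>v\<in>H. cap n v \<tau>) = unit_sphere n"

definition hitting_sets :: "nat \<Rightarrow> real \<Rightarrow> real \<Rightarrow> real vec set set" where
  "hitting_sets n \<tau> m = {H. hitting_set n \<tau> H \<and> real (card H) \<le> m}"

definition num_parts :: "real \<Rightarrow> real \<Rightarrow> nat \<Rightarrow> nat" where
  "num_parts \<alpha> \<beta> n = nat \<lceil>log \<beta> (\<alpha> * real n)\<rceil>"

text \<open>
  A tuple \<open>(I\<^sub>1, \<dots>, I\<^sub>m)\<close> is a function on indices of which only the values at
  \<open>1, \<dots>, m\<close> matter. The cardinalities are compared as integers to avoid truncated subtraction.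
\<close>

definition admissible_partition :: "real \<Rightarrow> real \<Rightarrow> nat \<Rightarrow> (nat \<Rightarrow> nat set) \<Rightarrow> bool" where
  "admissible_partition \<alpha> \<beta> n I \<longleftrightarrow>
     (let m = num_parts \<alpha> \<beta> n in
       (\<Union>k\<in>{1..m}. I k) = {0..<n} \<and>
       (\<forall>k\<in>{1..m}. \<forall>l\<in>{1..m}. k \<noteq> l \<longrightarrow> I k \<inter> I l = {}) \<and>
       (\<forall>k\<in>{2..m}. int (card (I k)) = \<lfloor>\<alpha> * real n / \<beta> ^ (k - 1)\<rfloor>) \<and>
       int (card (I 1)) = int n - (\<Sum>k=2..m. int (card (I k))))"

definition Z_part :: "real \<Rightarrow> real \<Rightarrow> nat \<Rightarrow> (nat \<Rightarrow> nat set) \<Rightarrow> real vec set" where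
  "Z_part \<alpha> \<beta> n I =
     {z \<in> carrier_vec n. \<forall>k\<in>{1..num_parts \<alpha> \<beta> n}. \<forall>i\<in>I k.
        z $ i \<in> {1, -1, \<beta> powr ((real k - 1) / 2), - (\<beta> powr ((real k - 1) / 2))}}"

definition Z_set :: "real \<Rightarrow> real \<Rightarrow> nat \<Rightarrow> real vec set" where
  "Z_set \<alpha> \<beta> n = (\<Union>I\<in>{I. admissible_partition \<alpha> \<beta> n I}. Z_part \<alpha> \<beta> n I)"

text \<open>
  For \<open>n = 1\<close>, \<open>\<alpha> = 1\<close> one has \<open>m = 0\<close> and there is no admissible partition;
  the value \<open>{1, -1}\<close> is set by convention.
\<close>

definition H3 :: "real \<Rightarrow> real \<Rightarrow> nat \<Rightarrow> real vec set" where
  "H3 \<alpha> \<beta> n =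
     (if n = 1 \<and> \<alpha> = 1 then {vec 1 (\<lambda>_. 1), vec 1 (\<lambda>_. -1)}
      else (\<lambda>z. (1 / eucl_norm z) \<cdot>\<^sub>v z) ` Z_set \<alpha> \<beta> n)"

definition std_basis :: "nat \<Rightarrow> real vec set" where
  "std_basis k = {unit_vec k i | i. i < k}"

definition kron_vec :: "real vec \<Rightarrow> real vec \<Rightarrow> real vec" where
  "kron_vec x y =
     vec (dim_vec x * dim_vec y) (\<lambda>i. x $ (i div dim_vec y) * y $ (i mod dim_vec y))"

definition kron_set :: "real vec set \<Rightarrow> real vec set \<Rightarrow> real vec set" where
  "kron_set A B = {kron_vec x y | x y. x \<in> A \<and> y \<in> B}"

definition concat_set :: "real vec set \<Rightarrow> real vec set \<Rightarrow> real vec set" where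
  "concat_set A B = {x @\<^sub>v y | x y. x \<in> A \<and> y \<in> B}"

definition H5 :: "real \<Rightarrow> real \<Rightarrow> nat \<Rightarrow> real vec set" where
  "H5 \<alpha> \<beta> n =
     (let n1 = nat \<lceil>ln (real n)\<rceil>; n2 = n div n1; n3 = n - n1 * n2 in
       concat_set (kron_set (std_basis n2) (H3 \<alpha> \<beta> n1)) {0\<^sub>v n3} \<union>
       (if n3 = 0 then {} else concat_set {0\<^sub>v (n1 * n2)} (H3 \<alpha> \<beta> n3)))"

end

theory Submission
  imports Defs
begin

text \<open>
  Cut \<open>{0..<n}\<close> into consecutive blocks of length \<open>n\<^sub>1 = \<lceil>ln n\<rceil>\<close>, the last one possibly
  shorter. The elements of \<^term>\<open>H5 \<alpha> \<beta> n\<close> are exactly the vectors that carry an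
  element of the appropriate \<^term>\<open>H3 \<alpha> \<beta> k\<close> on one block and vanish elsewhere.
  If there are \<open>N\<close> blocks, the squared norms of the restrictions of a unit vector \<open>x\<close> to the
  blocks add up to 1, so some restriction \<open>y\<close> has norm at least \<open>1 / sqrt N\<close>. A suitable
  vector \<open>h\<close> for that block satisfies \<open>y \<bullet> h \<ge> \<mu> * norm y\<close>, and \<open>y \<bullet> h\<close> is also the scalar product
  of \<open>x\<close> with the extension of \<open>h\<close> by zero. Hence such a union of blockwise hitting sets is a
  \<open>\<mu> / sqrt N\<close>-hitting set (lemma \<open>hitting_set_blocks\<close>), and
  \<open>N = \<lceil>n / n\<^sub>1\<rceil> < n / ln n + 1\<close> gives the stated threshold.

  For the cardinality, each of the at most \<open>n + 1\<close> blocks contributes at most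
  \<open>\<nu> ^ n\<^sub>1 \<le> \<nu> powr (ln n + 1) = \<nu> * n powr ln \<nu>\<close> vectors; here \<open>\<nu> \<ge> 1\<close> because a hitting set
  of a nonempty sphere is nonempty.
\<close>

section \<open>Restriction to a block and extension by zero\<close>

definition extend_vec :: "nat \<Rightarrow> nat \<Rightarrow> real vec \<Rightarrow> real vec" where
  "extend_vec n s h = vec n (\<lambda>i. if s \<le> i \<and> i < s + dim_vec h then h $ (i - s) else 0)"

definition slice_vec :: "nat \<Rightarrow> nat \<Rightarrow> real vec \<Rightarrow> real vec" where
  "slice_vec s k x = vec k (\<lambda>i. x $ (s + i))"

text \<open>Restricting to a block is adjoint to extending by zero outside it.\<close>

lemma scalar_prod_extend_vec:
  assumes "s + dim_vec h \<le> n"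
  shows "x \<bullet> extend_vec n s h = slice_vec s (dim_vec h) x \<bullet> h"
proof -
  have "x \<bullet> extend_vec n s h =
      (\<Sum>i\<in>{0..<n}. x $ i * (if s \<le> i \<and> i < s + dim_vec h then h $ (i - s) else 0))"
    by (simp add: scalar_prod_def extend_vec_def)
  also have "\<dots> = (\<Sum>i\<in>{s..<s + dim_vec h}. x $ i * h $ (i - s))"
    using assms by (intro sum.mono_neutral_cong_right) auto
  also have "\<dots> = (\<Sum>i\<in>{0..<dim_vec h}. x $ (s + i) * h $ i)"
    by (rule sum.reindex_bij_witness[where i = "\<lambda>i. s + i" and j = "\<lambda>i. i - s"]) auto
  also have "\<dots> = slice_vec s (dim_vec h) x \<bullet> h"
    by (simp add: scalar_prod_def slice_vec_def)
  finally show ?thesis .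
qed

lemma slice_vec_extend_vec:
  assumes "s + dim_vec h \<le> n"
  shows "slice_vec s (dim_vec h) (extend_vec n s h) = h"
  using assms by (intro eq_vecI) (auto simp: slice_vec_def extend_vec_def)

lemma extend_vec_unit_sphere:
  assumes "h \<in> unit_sphere k" "s + k \<le> n"
  shows "extend_vec n s h \<in> unit_sphere n"
proof -
  have [simp]: "dim_vec h = k"
    using assms by (auto simp: unit_sphere_def)
  have "extend_vec n s h \<bullet> extend_vec n s h = h \<bullet> h"
    using assms scalar_prod_extend_vec[of s h n] slice_vec_extend_vec[of s h n] by simp
  then show ?thesis
    using assms by (simp add: unit_sphere_def eucl_norm_def extend_vec_def)
qed

lemma slice_vec_scalar_prod_self:
  "slice_vec s k x \<bullet> slice_vec s k x = (\<Sum>i\<in>{s..<s + k}. x $ i * x $ i)"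
proof -
  have "slice_vec s k x \<bullet> slice_vec s k x = (\<Sum>i\<in>{0..<k}. x $ (s + i) * x $ (s + i))"
    by (simp add: scalar_prod_def slice_vec_def)
  also have "\<dots> = (\<Sum>i\<in>{s..<s + k}. x $ i * x $ i)"
    by (rule sum.reindex_bij_witness[where i = "\<lambda>i. i - s" and j = "\<lambda>i. s + i"]) auto
  finally show ?thesis .
qed

section \<open>Hitting sets\<close>

lemma hitting_set_mono:
  assumes "hitting_set n \<tau> H" "-1 \<le> \<tau>'" "\<tau>' \<le> \<tau>"
  shows "hitting_set n \<tau>' H"
proof -
  have "cap n v \<tau> \<subseteq> cap n v \<tau>'" for v
    using assms by (auto simp: cap_def)
  then have "unit_sphere n \<subseteq> (\<Union>v\<in>H. cap n v \<tau>')"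
    using assms unfolding hitting_set_def by blast
  moreover have "(\<Union>v\<in>H. cap n v \<tau>') \<subseteq> unit_sphere n"
    by (auto simp: cap_def)
  ultimately show ?thesis
    using assms by (auto simp: hitting_set_def)
qed

text \<open>The defining property of a hitting set, scaled from the sphere to all nonzero vectors.\<close>

lemma hitting_set_homogeneous:
  assumes "hitting_set k \<tau> H" "y \<in> carrier_vec k" "eucl_norm y > 0"
  obtains v where "v \<in> H" "y \<bullet> v \<ge> \<tau> * eucl_norm y"
proof -
  define c where "c = 1 / eucl_norm y"
  have c: "c > 0"
    using assms by (simp add: c_def)
  have yy: "y \<bullet> y = (eucl_norm y)\<^sup>2"
    using assms(3) by (simp add: eucl_norm_def)
  have "(c \<cdot>\<^sub>v y) \<bullet> (c \<cdot>\<^sub>v y) = c * (c * (y \<bullet> y))"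
    using assms(2) by (simp add: scalar_prod_smult_left scalar_prod_smult_right)
  also have "\<dots> = 1"
    using assms(3) by (simp add: yy c_def power2_eq_square)
  finally have "c \<cdot>\<^sub>v y \<in> unit_sphere k"
    using assms(2) by (simp add: unit_sphere_def eucl_norm_def)
  then obtain v where v: "v \<in> H" "c \<cdot>\<^sub>v y \<in> cap k v \<tau>"
    using assms(1) unfolding hitting_set_def by blast
  have "v \<in> carrier_vec k"
    using v assms(1) by (auto simp: hitting_set_def unit_sphere_def)
  then have "\<tau> \<le> c * (y \<bullet> v)"
    using v assms(2) by (simp add: cap_def)
  then have "y \<bullet> v \<ge> \<tau> * eucl_norm y"
    using assms(3) by (simp add: c_def field_simps)
  with v show thesis
    using that by blast
qed

text \<open>
  Pigeonhole principle over a partition of the coordinates: one of the blocks carries at least the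
  fraction \<open>1 / card J\<close> of the squared norm, and there the hitting set of that block does the work.
\<close>

lemma hitting_set_blocks:
  fixes s l :: "'j \<Rightarrow> nat" and H :: "'j \<Rightarrow> real vec set"
  assumes J: "finite J" and n: "n > 0" and \<tau>: "0 \<le> \<tau>" "\<tau> \<le> 1"
    and cover: "(\<Union>j\<in>J. {s j..<s j + l j}) = {0..<n}"
    and disj: "disjoint_family_on (\<lambda>j. {s j..<s j + l j}) J"
    and le: "\<And>j. j \<in> J \<Longrightarrow> s j + l j \<le> n"
    and H: "\<And>j. j \<in> J \<Longrightarrow> hitting_set (l j) \<tau> (H j)"
  shows "hitting_set n (\<tau> / sqrt (card J)) (\<Union>j\<in>J. extend_vec n (s j) ` H j)"
    (is "hitting_set n ?\<tau> ?H")
proof -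
  have J0: "J \<noteq> {}"
    using cover n by auto
  then have cJ: "real (card J) \<ge> 1"
    using J by (simp add: Suc_le_eq card_gt_0_iff)
  have sub: "?H \<subseteq> unit_sphere n"
  proof
    fix v assume "v \<in> ?H"
    then obtain j h where jh: "j \<in> J" "h \<in> H j" "v = extend_vec n (s j) h"
      by blast
    then have "h \<in> unit_sphere (l j)"
      using H by (auto simp: hitting_set_def)
    then show "v \<in> unit_sphere n"
      using jh le by (simp add: extend_vec_unit_sphere)
  qed
  have hit: "\<exists>v\<in>?H. x \<in> cap n v ?\<tau>" if x: "x \<in> unit_sphere n" for x
  proof -
    let ?y = "\<lambda>j. slice_vec (s j) (l j) x"
    have dx: "dim_vec x = n" and "x \<bullet> x = 1"
      using x by (auto simp: unit_sphere_def eucl_norm_def)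
    then have "1 = (\<Sum>i\<in>(\<Union>j\<in>J. {s j..<s j + l j}). x $ i * x $ i)"
      by (simp add: cover scalar_prod_def)
    also have "\<dots> = (\<Sum>j\<in>J. ?y j \<bullet> ?y j)"
      unfolding slice_vec_scalar_prod_self
      using J disj by (intro sum.UNION_disjoint_family) auto
    finally have total: "(\<Sum>j\<in>J. ?y j \<bullet> ?y j) = 1" ..
    have "\<exists>j\<in>J. ?y j \<bullet> ?y j \<ge> 1 / card J"
    proof (rule ccontr)
      assume "\<not> ?thesis"
      then have "(\<Sum>j\<in>J. ?y j \<bullet> ?y j) < (\<Sum>j\<in>J. 1 / card J)"
        using J J0 by (intro sum_strict_mono) auto
      then show False
        using total cJ by simp
    qed
    then obtain j where j: "j \<in> J" "?y j \<bullet> ?y j \<ge> 1 / card J"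
      by blast
    have norm: "eucl_norm (?y j) \<ge> 1 / sqrt (card J)"
      using real_sqrt_le_mono[OF j(2)] by (simp add: eucl_norm_def real_sqrt_divide)
    moreover have "1 / sqrt (card J) > 0"
      using cJ by simp
    ultimately have "eucl_norm (?y j) > 0"
      by linarith
    moreover have "?y j \<in> carrier_vec (l j)"
      by (simp add: slice_vec_def)
    ultimately obtain h where h: "h \<in> H j" "?y j \<bullet> h \<ge> \<tau> * eucl_norm (?y j)"
      using hitting_set_homogeneous[OF H[OF j(1)]] by blast
    have dh: "dim_vec h = l j"
      using h(1) H[OF j(1)] by (auto simp: hitting_set_def unit_sphere_def)
    have "?\<tau> \<le> \<tau> * eucl_norm (?y j)"
      using mult_left_mono[OF norm \<tau>(1)] by simp
    also have "\<dots> \<le> x \<bullet> extend_vec n (s j) h"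
      using h(2) le[OF j(1)] by (simp add: scalar_prod_extend_vec dh)
    finally show ?thesis
      using x h(1) j(1) by (auto simp: cap_def)
  qed
  have "?\<tau> \<ge> 0" "?\<tau> \<le> 1"
    using \<tau> cJ by (auto simp: divide_le_eq_1 intro: order_trans[OF _ iffD2[OF real_sqrt_ge_1_iff]])
  moreover have "finite ?H"
    using J H by (auto simp: hitting_set_def)
  moreover have "(\<Union>v\<in>?H. cap n v ?\<tau>) = unit_sphere n"
    using hit by (fastforce simp: cap_def)
  ultimately show ?thesis
    using sub by (simp add: hitting_set_def)
qed

section \<open>Decomposition into blocks of logarithmic length\<close>

text \<open>The Kronecker product with a basis vector places its second factor on one block.\<close>

lemma kron_unit_append_zero:
  assumes "j < q"
  shows "kron_vec (unit_vec q j) h @\<^sub>v 0\<^sub>v r = extend_vec (dim_vec h * q + r) (j * dim_vec h) h"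
proof (rule eq_vecI)
  show "dim_vec (kron_vec (unit_vec q j) h @\<^sub>v 0\<^sub>v r) =
      dim_vec (extend_vec (dim_vec h * q + r) (j * dim_vec h) h)"
    by (simp add: kron_vec_def extend_vec_def)
next
  fix i
  assume "i < dim_vec (extend_vec (dim_vec h * q + r) (j * dim_vec h) h)"
  then have i: "i < dim_vec h * q + r"
    by (simp add: extend_vec_def)
  let ?k = "dim_vec h"
  have end_le: "j * ?k + ?k \<le> ?k * q"
    using mult_le_mono2[of "Suc j" q ?k] assms by (simp add: mult.commute)
  show "(kron_vec (unit_vec q j) h @\<^sub>v 0\<^sub>v r) $ i = extend_vec (?k * q + r) (j * ?k) h $ i"
  proof (cases "i < ?k * q")
    case False
    then show ?thesis
      using i end_le by (simp add: kron_vec_def extend_vec_def mult.commute)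
  next
    case True
    then have k0: "?k > 0"
      by (cases "?k = 0") auto
    have divq: "i div ?k < q"
      using True k0 by (simp add: less_mult_imp_div_less mult.commute)
    have iff: "i div ?k = j \<longleftrightarrow> j * ?k \<le> i \<and> i < j * ?k + ?k"
    proof
      assume "i div ?k = j"
      then show "j * ?k \<le> i \<and> i < j * ?k + ?k"
        using k0 dividend_less_div_times[of ?k i] by auto
    next
      assume "j * ?k \<le> i \<and> i < j * ?k + ?k"
      then show "i div ?k = j"
        by (intro div_nat_eqI) (auto simp: mult.commute)
    qed
    show ?thesis
    proof (cases "i div ?k = j")
      case eq: True
      then have "i mod ?k = i - j * ?k"
        by (metis minus_div_mult_eq_mod)
      then show ?thesis
        using True i divq eq iff assms by (simp add: kron_vec_def extend_vec_def mult.commute)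
    next
      case False
      then show ?thesis
        using True i divq iff assms by (auto simp: kron_vec_def extend_vec_def mult.commute)
    qed
  qed
qed

lemma zero_append_eq_extend_vec:
  "0\<^sub>v a @\<^sub>v h = extend_vec (a + dim_vec h) a h"
  by (intro eq_vecI) (auto simp: extend_vec_def)

lemma H5_eq_blocks:
  fixes n :: nat
  defines "n1 \<equiv> nat \<lceil>ln (real n)\<rceil>"
  defines "n2 \<equiv> n div n1"
  defines "n3 \<equiv> n - n1 * n2"
  assumes H1: "H3 \<alpha> \<beta> n1 \<subseteq> carrier_vec n1" and H2: "n3 > 0 \<Longrightarrow> H3 \<alpha> \<beta> n3 \<subseteq> carrier_vec n3"
  shows "H5 \<alpha> \<beta> n =
    (\<Union>j<n2 + of_bool (n3 > 0). extend_vec n (j * n1) ` H3 \<alpha> \<beta> (if j < n2 then n1 else n3))"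
proof -
  have n: "n = n1 * n2 + n3"
    by (simp add: n3_def n2_def)
  have full: "concat_set (kron_set (std_basis n2) (H3 \<alpha> \<beta> n1)) {0\<^sub>v n3} =
      (\<Union>j<n2. extend_vec n (j * n1) ` H3 \<alpha> \<beta> n1)"
  proof -
    have "concat_set (kron_set (std_basis n2) (H3 \<alpha> \<beta> n1)) {0\<^sub>v n3} =
        (\<Union>j<n2. (\<lambda>h. kron_vec (unit_vec n2 j) h @\<^sub>v 0\<^sub>v n3) ` H3 \<alpha> \<beta> n1)"
      unfolding concat_set_def kron_set_def std_basis_def by blast
    also have "\<dots> = (\<Union>j<n2. extend_vec n (j * n1) ` H3 \<alpha> \<beta> n1)"
    proof (intro SUP_cong refl image_cong)
      fix j h
      assume "j \<in> {..<n2}" "h \<in> H3 \<alpha> \<beta> n1"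
      then show "kron_vec (unit_vec n2 j) h @\<^sub>v 0\<^sub>v n3 = extend_vec n (j * n1) h"
        using H1 kron_unit_append_zero[of j n2 h n3] n by auto
    qed
    finally show ?thesis .
  qed
  have rest: "concat_set {0\<^sub>v (n1 * n2)} (H3 \<alpha> \<beta> n3) = extend_vec n (n2 * n1) ` H3 \<alpha> \<beta> n3"
    if "n3 > 0"
  proof -
    have "concat_set {0\<^sub>v (n1 * n2)} (H3 \<alpha> \<beta> n3) = (\<lambda>h. 0\<^sub>v (n1 * n2) @\<^sub>v h) ` H3 \<alpha> \<beta> n3"
      unfolding concat_set_def by blast
    also have "\<dots> = extend_vec n (n2 * n1) ` H3 \<alpha> \<beta> n3"
    proof (rule image_cong[OF refl])
      fix h
      assume "h \<in> H3 \<alpha> \<beta> n3"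
      then have "dim_vec h = n3"
        using H2[OF that] by auto
      then show "0\<^sub>v (n1 * n2) @\<^sub>v h = extend_vec n (n2 * n1) h"
        using zero_append_eq_extend_vec[of "n1 * n2" h] n by (simp add: mult.commute)
    qed
    finally show ?thesis .
  qed
  have "H5 \<alpha> \<beta> n = concat_set (kron_set (std_basis n2) (H3 \<alpha> \<beta> n1)) {0\<^sub>v n3} \<union>
      (if n3 = 0 then {} else concat_set {0\<^sub>v (n1 * n2)} (H3 \<alpha> \<beta> n3))"
    by (simp add: H5_def Let_def n1_def n2_def n3_def)
  also have "\<dots> = (\<Union>j<n2. extend_vec n (j * n1) ` H3 \<alpha> \<beta> n1) \<union>
      (if n3 = 0 then {} else extend_vec n (n2 * n1) ` H3 \<alpha> \<beta> n3)"
    using full rest by simp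
  also have "\<dots> =
      (\<Union>j<n2 + of_bool (n3 > 0). extend_vec n (j * n1) ` H3 \<alpha> \<beta> (if j < n2 then n1 else n3))"
    by (cases "n3 = 0") (auto simp: lessThan_Suc)
  finally show ?thesis .
qed

lemma consecutive_blocks_cover:
  fixes d q r :: nat
  assumes "r < d"
  shows "(\<Union>j<q + of_bool (r > 0). {j * d..<j * d + (if j < q then d else r)}) = {0..<d * q + r}"
    (is "(\<Union>j<?N. ?B j) = _")
proof (intro equalityI subsetI)
  fix i
  assume "i \<in> (\<Union>j<?N. ?B j)"
  then obtain j where j: "j < ?N" "i \<in> ?B j"
    by blast
  show "i \<in> {0..<d * q + r}"
  proof (cases "j < q")
    case True
    then have "Suc j * d \<le> q * d"
      by (intro mult_le_mono1) simp
    then show ?thesis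
      using j True by (simp add: mult.commute)
  next
    case False
    then have "j = q"
      using j(1) by (cases "r > 0") auto
    then show ?thesis
      using j by (simp add: mult.commute)
  qed
next
  fix i
  assume i: "i \<in> {0..<d * q + r}"
  have d: "d > 0"
    using assms by simp
  show "i \<in> (\<Union>j<?N. ?B j)"
  proof (cases "i < d * q")
    case True
    then have "i div d < q"
      by (simp add: less_mult_imp_div_less mult.commute)
    moreover have "i div d * d \<le> i" "i < i div d * d + d"
      using dividend_less_div_times[OF d, of i] by auto
    ultimately show ?thesis
      by (intro UN_I[of "i div d"]) auto
  next
    case False
    then show ?thesis
      using i by (intro UN_I[of q]) (auto simp: mult.commute)
  qed
qed

lemma consecutive_blocks_disjoint:
  fixes d :: nat
  assumes "\<And>j. l j \<le> d"
  shows "disjoint_family_on (\<lambda>j. {j * d..<j * d + l j}) J"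
proof -
  have "{i * d..<i * d + l i} \<inter> {j * d..<j * d + l j} = {}" if "i < j" for i j
  proof -
    have "Suc i * d \<le> j * d"
      using that by (intro mult_le_mono1) simp
    then show ?thesis
      using assms[of i] by auto
  qed
  then show ?thesis
    unfolding disjoint_family_on_def by (metis inf_commute linorder_neqE_nat)
qed

theorem theorem2p15:
  fixes \<alpha> \<beta> \<mu> \<nu> :: real
  assumes "\<alpha> \<ge> 1" and "\<beta> \<ge> \<alpha> + 1"
    and "\<mu> > 0" and "\<nu> > 0"
    and "\<And>k::nat. k \<ge> 1 \<Longrightarrow> H3 \<alpha> \<beta> k \<in> hitting_sets k \<mu> (\<nu> ^ k)"
  shows "\<exists>C::real. C > 0 \<and>
    (\<forall>n::nat. n \<ge> 2 \<longrightarrow>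
      H5 \<alpha> \<beta> n \<in> hitting_sets n
        (\<mu> * sqrt (ln (real n) / (real n + ln (real n))))
        (C * real n powr (1 + ln \<nu>)))"
proof -
  have hit: "hitting_set k \<mu> (H3 \<alpha> \<beta> k)" and card: "real (card (H3 \<alpha> \<beta> k)) \<le> \<nu> ^ k"
    if "k \<ge> 1" for k
    using assms(5)[OF that] by (auto simp: hitting_sets_def)
  have carrier: "H3 \<alpha> \<beta> k \<subseteq> carrier_vec k" if "k \<ge> 1" for k
    using hit[OF that] by (auto simp: hitting_set_def unit_sphere_def)
  have \<mu>1: "\<mu> \<le> 1"
    using hit[of 1] by (simp add: hitting_set_def)
  have \<nu>1: "\<nu> \<ge> 1"
  proof -
    have "vec 1 (\<lambda>_. 1) \<in> unit_sphere 1"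
      by (simp add: unit_sphere_def eucl_norm_def scalar_prod_def)
    then have "H3 \<alpha> \<beta> 1 \<noteq> {}" "finite (H3 \<alpha> \<beta> 1)"
      using hit[of 1] by (auto simp: hitting_set_def)
    then have "card (H3 \<alpha> \<beta> 1) \<ge> 1"
      by (simp add: Suc_le_eq card_gt_0_iff)
    then show ?thesis
      using card[of 1] by simp
  qed
  have "H5 \<alpha> \<beta> n \<in> hitting_sets n (\<mu> * sqrt (ln (real n) / (real n + ln (real n))))
      (2 * \<nu> * real n powr (1 + ln \<nu>))" if n: "n \<ge> 2" for n
  proof -
    define n1 where "n1 = nat \<lceil>ln (real n)\<rceil>"
    define n2 where "n2 = n div n1"
    define n3 where "n3 = n - n1 * n2"
    define N where "N = n2 + of_bool (n3 > 0)"
    define l where "l = (\<lambda>j. if j < n2 then n1 else n3)"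
    have ln0: "ln (real n) > 0"
      using n by simp
    have n1_ge: "ln (real n) \<le> real n1" and n1_le: "real n1 \<le> ln (real n) + 1"
      using ln0 unfolding n1_def by linarith+
    have n1: "n1 \<ge> 1"
      using ln0 unfolding n1_def by linarith
    have n_eq: "n = n1 * n2 + n3" and "n3 = n mod n1"
      by (simp_all add: n3_def n2_def minus_mult_div_eq_mod)
    then have n31: "n3 < n1"
      using n1 by simp
    have l: "1 \<le> l j" "l j \<le> n1" if "j < N" for j
      using that n1 n31 by (cases "n3 = 0"; auto simp: l_def N_def)+
    have cover: "(\<Union>j<N. {j * n1..<j * n1 + l j}) = {0..<n}"
      unfolding N_def l_def n_eq by (rule consecutive_blocks_cover[OF n31])
    have N0: "N > 0"
      using cover n by (cases "N = 0") auto
    have H5: "H5 \<alpha> \<beta> n = (\<Union>j<N. extend_vec n (j * n1) ` H3 \<alpha> \<beta> (l j))"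
      unfolding N_def l_def n1_def n2_def n3_def
      by (rule H5_eq_blocks)
         (use n1 carrier in \<open>auto simp: Suc_le_eq simp flip: n1_def n2_def n3_def\<close>)
    have le: "j * n1 + l j \<le> n" if "j < N" for j
    proof -
      \<comment> \<open>A block is nonempty, so its last coordinate belongs to the covered range.\<close>
      have "j * n1 + l j - 1 \<in> {0..<n}"
        unfolding cover[symmetric] using that l(1)[of j] by (intro UN_I[of j]) auto
      then show ?thesis
        by simp
    qed
    have "hitting_set n (\<mu> / sqrt (card {..<N})) (H5 \<alpha> \<beta> n)"
      unfolding H5
    proof (rule hitting_set_blocks[where l = l])
      show "disjoint_family_on (\<lambda>j. {j * n1..<j * n1 + l j}) {..<N}"
        using n31 by (intro consecutive_blocks_disjoint) (auto simp: l_def)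
    qed (use le n assms(3) \<mu>1 cover hit l in auto)
    then have hitN: "hitting_set n (\<mu> / sqrt N) (H5 \<alpha> \<beta> n)"
      by simp
    have "(N - 1) * n1 < n"
      using le[of "N - 1"] l(1)[of "N - 1"] N0 by simp
    then have "real (N - 1) * real n1 < real n"
      by (metis of_nat_less_iff of_nat_mult)
    moreover have "real (N - 1) * ln (real n) \<le> real (N - 1) * real n1"
      using n1_ge by (intro mult_left_mono) auto
    ultimately have "(real N - 1) * ln (real n) \<le> real n"
      using N0 by (simp add: of_nat_diff Suc_le_eq)
    moreover have "real n + ln (real n) > 0"
      using ln0 by linarith
    ultimately have "ln (real n) / (real n + ln (real n)) \<le> 1 / real N"
      using N0 by (simp add: divide_simps algebra_simps)
    then have "sqrt (ln (real n) / (real n + ln (real n))) \<le> 1 / sqrt N"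
      by (metis real_sqrt_le_mono real_sqrt_divide real_sqrt_one)
    then have "\<mu> * sqrt (ln (real n) / (real n + ln (real n))) \<le> \<mu> / sqrt N"
      using mult_left_mono[of _ _ \<mu>] assms(3) by fastforce
    moreover have "\<mu> * sqrt (ln (real n) / (real n + ln (real n))) \<ge> 0"
      using ln0 assms(3) by simp
    ultimately have hit5: "hitting_set n (\<mu> * sqrt (ln (real n) / (real n + ln (real n)))) (H5 \<alpha> \<beta> n)"
      by (intro hitting_set_mono[OF hitN]) auto
    have "\<nu> ^ n1 = \<nu> powr real n1"
      using assms(4) by (simp add: powr_realpow)
    also have "\<dots> \<le> \<nu> powr (ln (real n) + 1)"
      using n1_le \<nu>1 by (intro powr_mono) auto
    also have "\<dots> = \<nu> * real n powr ln \<nu>"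
      using assms(4) n by (simp add: powr_def exp_add algebra_simps)
    finally have pow: "\<nu> ^ n1 \<le> \<nu> * real n powr ln \<nu>" .
    have block: "real (card (extend_vec n (j * n1) ` H3 \<alpha> \<beta> (l j))) \<le> \<nu> * real n powr ln \<nu>"
      if "j < N" for j
    proof -
      have "finite (H3 \<alpha> \<beta> (l j))"
        using hit[OF l(1)[OF that]] by (simp add: hitting_set_def)
      then have "real (card (extend_vec n (j * n1) ` H3 \<alpha> \<beta> (l j))) \<le> real (card (H3 \<alpha> \<beta> (l j)))"
        by (simp add: card_image_le)
      also have "\<dots> \<le> \<nu> ^ l j"
        using card[OF l(1)[OF that]] .
      also have "\<dots> \<le> \<nu> ^ n1"
        using \<nu>1 l(2)[OF that] by (intro power_increasing) auto
      finally show ?thesis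
        using pow by linarith
    qed
    have "N \<le> n + 1"
      by (cases "n3 > 0") (auto simp: N_def n2_def intro: le_SucI)
    then have N2: "real N \<le> 2 * real n"
      using n by linarith
    have "card (H5 \<alpha> \<beta> n) \<le> (\<Sum>j<N. card (extend_vec n (j * n1) ` H3 \<alpha> \<beta> (l j)))"
      unfolding H5 by (rule card_UN_le) simp
    then have "real (card (H5 \<alpha> \<beta> n)) \<le>
        (\<Sum>j<N. real (card (extend_vec n (j * n1) ` H3 \<alpha> \<beta> (l j))))"
      by (metis of_nat_le_iff of_nat_sum)
    also have "\<dots> \<le> (\<Sum>j<N. \<nu> * real n powr ln \<nu>)"
      using block by (intro sum_mono) auto
    also have "\<dots> = real N * (\<nu> * real n powr ln \<nu>)"
      by simp
    also have "\<dots> \<le> 2 * real n * (\<nu> * real n powr ln \<nu>)"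
      using N2 assms(4) by (intro mult_right_mono) auto
    also have "\<dots> = 2 * \<nu> * real n powr (1 + ln \<nu>)"
      using n by (simp add: powr_add)
    finally show ?thesis
      using hit5 by (simp add: hitting_sets_def)
  qed
  then show ?thesis
    using assms(4) by (intro exI[of _ "2 * \<nu>"]) auto
qed

end
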